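(* Let $p_4(n)$ denote the number of partitions of $n$ into parts congruent to $\pm 2, \pm 3, \pm 7, \pm 8,\pm 12,\pm 13 \pmod{30}$, where the parts congruent to $\pm 2, \pm 3,\pm 8, \pm 12 \pmod{30}$ have two colors. Let $p_5(n)$ denote the number of partitions of $n$ into parts congruent to $\pm 1, \pm 4,\pm 6, \pm 9, \pm 11,\pm 14 \pmod{30}$, where the parts congruent to $\pm 4, \pm 6, \pm 9, \pm 14 \pmod{30}$ have two colors. Let $p_6(n)$ denote the number of partitions of $n$ into parts congruent to $\pm 2, \pm 3,\pm 4, \pm 5,\pm 6, \pm8,\pm 9, \pm 12, \pm 14 \pmod{30}$, where the parts congruent to $\pm 5 \pmod{30}$ have two colors. Then for each positive integer $n>1$, \[ p_4(n)-p_5(n-2)=p_6(n). \]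
   Context: A partition in which parts from certain residue classes "have two colors" means each such part size may appear in two distinguishable copies (colors), so the generating function for parts $\equiv r \pmod{s}$ with $k$ colors is $\prod_{m\ge0}(1-q^{sm+r})^{-k}$. Here $\pm r \pmod{30}$ means the classes $r$ and $30-r$ modulo $30$; parts are positive integers. By convention $p_i(0)=1$. *)

theory Defs
  imports "HOL-Library.Multiset" "HOL-Number_Theory.Cong"
begin

definition in_pm_classes30 :: "nat set \<Rightarrow> nat \<Rightarrow> bool" where
  "in_pm_classes30 R k \<longleftrightarrow> (\<exists>r\<in>R. [k = r] (mod 30) \<or> [k = 30 - r] (mod 30))"

(* Number of colors available for a part of size k when the allowed classes are
   R (up to sign, modulo 30) and those in T have two colors; 0 means that k is not allowed. *)
definition num_colors :: "nat set \<Rightarrow> nat set \<Rightarrow> nat \<Rightarrow> nat" where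
  "num_colors R T k =
     (if in_pm_classes30 R k then (if in_pm_classes30 T k then 2 else 1) else 0)"

(* A pair (k, i) is a part of size k in color i; the colors of k are 0, ..., c k - 1. *)
definition colored_partitions :: "(nat \<Rightarrow> nat) \<Rightarrow> nat \<Rightarrow> (nat \<times> nat) multiset set" where
  "colored_partitions c n =
     {M. (\<forall>(k, i) \<in># M. 0 < k \<and> i < c k) \<and> (\<Sum>(k, i)\<in>#M. k) = n}"

(* card is 0 on infinite sets, so the counts below rely on this. *)
lemma finite_colored_partitions: "finite (colored_partitions c n)"
proof -
  define A where "A = (SIGMA k:{..n}. {..<c k})"
  have fA: "finite A" by (simp add: A_def)
  have "colored_partitions c n \<subseteq> mset ` {xs. set xs \<subseteq> A \<and> length xs \<le> n}"
  proof
    fix M assume M: "M \<in> colored_partitions c n"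
    then have pos: "\<And>k i. (k, i) \<in># M \<Longrightarrow> 0 < k \<and> i < c k"
      and s: "(\<Sum>(k, i)\<in>#M. k) = n" by (auto simp: colored_partitions_def)
    have "set_mset M \<subseteq> A"
    proof
      fix x assume x: "x \<in># M"
      obtain k i where ki: "x = (k, i)" by (cases x)
      from x obtain M' where "M = add_mset x M'" by (metis multi_member_split)
      with s ki have "k \<le> n" by auto
      with pos x ki show "x \<in> A" by (auto simp: A_def)
    qed
    moreover have "size M \<le> (\<Sum>(k, i)\<in>#M. k)"
      using pos by (induction M) (fastforce)+
    moreover obtain xs where "M = mset xs" by (metis ex_mset)
    ultimately show "M \<in> mset ` {xs. set xs \<subseteq> A \<and> length xs \<le> n}"
      using s by (auto)
  qed
  then show ?thesis
    using finite_lists_length_le[OF fA] by (meson finite_imageI finite_subset)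
qed

definition p4 :: "nat \<Rightarrow> nat" where
  "p4 n = card (colored_partitions (num_colors {2, 3, 7, 8, 12, 13} {2, 3, 8, 12}) n)"

definition p5 :: "nat \<Rightarrow> nat" where
  "p5 n = card (colored_partitions (num_colors {1, 4, 6, 9, 11, 14} {4, 6, 9, 14}) n)"

definition p6 :: "nat \<Rightarrow> nat" where
  "p6 n = card (colored_partitions (num_colors {2, 3, 4, 5, 6, 8, 9, 12, 14} {5}) n)"

end

theory Submission
  imports Defs "HOL-Computational_Algebra.Formal_Power_Series"
begin

text \<open>
  Write \<open>\<theta>(z) = (z, p/z; p)\<close> with \<open>p = q^15\<close>, and \<open>J a = (q^a, q^(30-a); q^30)\<close>. The generating functions
  are reciprocals of products of the \<open>J a\<close>. Since \<open>\<theta>(q^a) = J a * J (15-a)\<close> and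
  \<open>\<theta>(-q^a) * \<theta>(q^a) = J (2*a)\<close>, the claim collapses to
  \<open>\<theta>(q^6)^2 \<theta>(-q^7) \<theta>(-q^2) - q^2 \<theta>(q^3)^2 \<theta>(-q^4) \<theta>(-q) = \<theta>(q^6) \<theta>(q^3) \<theta>(-q^5)^2\<close>,
  which is Weierstrass' three-term relation
  \<open>\<theta>(xy) \<theta>(x/y) \<theta>(uv) \<theta>(u/v) - \<theta>(xv) \<theta>(x/v) \<theta>(uy) \<theta>(u/y) = (u/y) \<theta>(yv) \<theta>(y/v) \<theta>(xu) \<theta>(x/u)\<close>
  at \<open>x = q^6\<close>, \<open>y = 1\<close>, \<open>u = q^3\<close>, \<open>v = -q^5\<close>.
  By the Jacobi triple product, \<open>y \<theta>(xy) \<theta>(x/y)\<close> is, up to a constant factor, a 2 by 2 determinant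
  with one row depending on \<open>x\<close> and the other on \<open>y\<close>; the relation is then the Pluecker relation
  between the minors of a 4 by 2 matrix.
  Infinite products are replaced by finite ones, and equations by congruences modulo powers of \<open>q\<close>.
\<close>

section \<open>Congruences of power series\<close>

lemma fps_X_power_dvd_iff:
  fixes f :: "'a::comm_ring_1 fps"
  shows "fps_X ^ N dvd f \<longleftrightarrow> (\<forall>i<N. fps_nth f i = 0)"
proof
  assume "\<forall>i<N. fps_nth f i = 0"
  then have "f = fps_X ^ N * fps_shift N f"
    by (intro fps_ext) (auto simp: fps_X_power_mult_nth)
  then show "fps_X ^ N dvd f" by (rule dvdI)
qed (auto simp: dvd_def fps_X_power_mult_nth)

text \<open>By induction all lower coefficients of \<open>f\<close> vanish, so the
  \<open>i\<close>-th coefficient of \<open>u * f\<close> reduces to that of \<open>f\<close> times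
  the constant term \<open>1\<close> of \<open>u\<close>.\<close>

lemma fps_X_power_dvd_mult_cancel:
  fixes f u :: "'a::comm_ring_1 fps"
  assumes "fps_X ^ N dvd u * f" "fps_nth u 0 = 1"
  shows "fps_X ^ N dvd f"
proof -
  have "fps_nth f i = 0" if "i < N" for i
    using that
  proof (induction i rule: less_induct)
    case (less i)
    have "0 = fps_nth (u * f) i"
      using assms(1) less.prems by (simp add: fps_X_power_dvd_iff)
    also have "\<dots> = (\<Sum>k=0..i. fps_nth f k * fps_nth u (i - k))"
      by (simp add: mult.commute[of u] fps_mult_nth)
    also have "\<dots> = (\<Sum>k\<in>{i}. fps_nth f k * fps_nth u (i - k))"
      using less by (intro sum.mono_neutral_right) auto
    finally show ?case using assms(2) by simp
  qed
  then show ?thesis by (simp add: fps_X_power_dvd_iff)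
qed

definition fps_cong :: "nat \<Rightarrow> 'a::comm_ring_1 fps \<Rightarrow> 'a fps \<Rightarrow> bool" where
  "fps_cong N f g \<longleftrightarrow> fps_X ^ N dvd f - g"

lemma fps_cong_refl [simp]: "fps_cong N f f"
  by (simp add: fps_cong_def)

lemma fps_cong_sym: "fps_cong N f g \<Longrightarrow> fps_cong N g f"
  by (metis fps_cong_def dvd_minus_iff minus_diff_eq)

lemma fps_cong_trans [trans]: "fps_cong N f g \<Longrightarrow> fps_cong N g h \<Longrightarrow> fps_cong N f h"
  unfolding fps_cong_def using dvd_add by fastforce

lemma fps_cong_diff: "fps_cong N f g \<Longrightarrow> fps_cong N f' g' \<Longrightarrow> fps_cong N (f - f') (g - g')"
  unfolding fps_cong_def using dvd_diff[of "fps_X ^ N" "f - g" "f' - g'"] by (simp add: algebra_simps)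

lemma fps_cong_mult:
  assumes "fps_cong N f g" "fps_cong N f' g'"
  shows "fps_cong N (f * f') (g * g')"
proof -
  have "f * f' - g * g' = (f - g) * f' + g * (f' - g')" by (simp add: algebra_simps)
  then show ?thesis using assms unfolding fps_cong_def by (metis dvd_add dvd_mult dvd_mult2)
qed

lemma fps_cong_sum:
  "(\<And>i. i \<in> I \<Longrightarrow> fps_cong N (f i) (g i)) \<Longrightarrow> fps_cong N (sum f I) (sum g I)"
  unfolding fps_cong_def by (simp add: dvd_sum flip: sum_subtractf)

lemma fps_cong_nth: "fps_cong N f g \<Longrightarrow> i < N \<Longrightarrow> fps_nth f i = fps_nth g i"
  by (simp add: fps_cong_def fps_X_power_dvd_iff)

lemma fps_cong_iff: "fps_cong N f g \<longleftrightarrow> (\<forall>i<N. fps_nth f i = fps_nth g i)"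
  by (simp add: fps_cong_def fps_X_power_dvd_iff)

lemma fps_cong_mono: "fps_cong N f g \<Longrightarrow> M \<le> N \<Longrightarrow> fps_cong M f g"
  by (simp add: fps_cong_iff)

lemma fps_cong_X_power_mult:
  "fps_cong N f g \<Longrightarrow> fps_cong (N + k) (fps_X ^ k * f) (fps_X ^ k * g)"
  by (auto simp: fps_cong_iff fps_X_power_mult_nth)

lemma fps_cong_mult_cancel:
  "fps_cong N (u * f) (u * g) \<Longrightarrow> fps_nth u 0 = 1 \<Longrightarrow> fps_cong N f g"
  unfolding fps_cong_def using fps_X_power_dvd_mult_cancel[of N u "f - g"]
  by (simp add: algebra_simps)

lemma fps_cong_one_minus_X_power: "N \<le> k \<Longrightarrow> fps_cong N (1 - fps_X ^ k) 1"
  by (simp add: fps_cong_def dvd_minus_iff le_imp_power_dvd)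

text \<open>The formal sum of \<open>c i * fps_X ^ e i\<close> over a whole index type. It has this
  meaning only when the fibres of \<open>e\<close> are finite, because a sum over an infinite set is
  \<open>0\<close>.\<close>

definition fibre_series :: "('i \<Rightarrow> nat) \<Rightarrow> ('i \<Rightarrow> 'a::comm_ring_1) \<Rightarrow> 'a fps" where
  "fibre_series e c = Abs_fps (\<lambda>n. \<Sum>i | e i = n. c i)"

text \<open>The pairs with \<open>e i + e' j = n\<close> are the disjoint union of the rectangles
  formed by the fibres over \<open>k\<close> and \<open>n - k\<close>, which is the Cauchy
  product.\<close>

lemma fibre_series_mult:
  assumes "\<And>n. finite {i. e i = n}" "\<And>n. finite {j. e' j = n}"
  shows "fibre_series e c * fibre_series e' c' =
    fibre_series (\<lambda>(i, j). e i + e' j) (\<lambda>(i, j). c i * c' j)"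
proof (rule fps_ext)
  fix n
  have "fps_nth (fibre_series e c * fibre_series e' c') n =
      (\<Sum>k=0..n. \<Sum>z\<in>{i. e i = k} \<times> {j. e' j = n - k}. case z of (i, j) \<Rightarrow> c i * c' j)"
    by (simp add: fps_mult_nth fibre_series_def sum_product sum.cartesian_product)
  also have "\<dots> = (\<Sum>z\<in>(\<Union>k\<in>{0..n}. {i. e i = k} \<times> {j. e' j = n - k}). case z of (i, j) \<Rightarrow> c i * c' j)"
    using assms by (intro sum.UNION_disjoint[symmetric]) auto
  also have "(\<Union>k\<in>{0..n}. {i. e i = k} \<times> {j. e' j = n - k}) = {z. (case z of (i, j) \<Rightarrow> e i + e' j) = n}"
    by auto
  finally show "fps_nth (fibre_series e c * fibre_series e' c') n =
      fps_nth (fibre_series (\<lambda>(i, j). e i + e' j) (\<lambda>(i, j). c i * c' j)) n"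
    by (simp add: fibre_series_def)
qed

lemma fibre_series_split:
  fixes f :: "'j \<Rightarrow> 'i" and g :: "'k \<Rightarrow> 'i"
  assumes "\<And>n. finite {i. e i = n}" "inj f" "inj g"
    and "range f \<inter> range g = {}" "range f \<union> range g = UNIV"
  shows "fibre_series e c = fibre_series (e \<circ> f) (c \<circ> f) + fibre_series (e \<circ> g) (c \<circ> g)"
proof (rule fps_ext)
  fix n
  have fin: "finite (f ` {j. e (f j) = n})" "finite (g ` {j. e (g j) = n})"
    by (auto intro: finite_subset[OF _ assms(1)[of n]])
  have "i \<in> range f \<union> range g" for i using assms(5) by simp
  then have eq: "{i. e i = n} = f ` {j. e (f j) = n} \<union> g ` {j. e (g j) = n}"
    by fast
  have "(\<Sum>i | e i = n. c i) = sum c (f ` {j. e (f j) = n}) + sum c (g ` {j. e (g j) = n})"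
    unfolding eq using assms(4) fin by (intro sum.union_disjoint) auto
  also have "\<dots> = (\<Sum>j | e (f j) = n. c (f j)) + (\<Sum>j | e (g j) = n. c (g j))"
    using assms(2,3) by (simp add: sum.reindex inj_on_subset)
  finally show "fps_nth (fibre_series e c) n =
      fps_nth (fibre_series (e \<circ> f) (c \<circ> f) + fibre_series (e \<circ> g) (c \<circ> g)) n"
    by (simp add: fibre_series_def)
qed

lemma fibre_series_X_power_mult:
  "fibre_series (\<lambda>i. k + e i) (\<lambda>i. a * c i) = fps_const a * (fps_X ^ k * fibre_series e c)"
proof (rule fps_ext)
  fix n
  have "{i. k + e i = n} = (if n < k then {} else {i. e i = n - k})" by auto
  then show "fps_nth (fibre_series (\<lambda>i. k + e i) (\<lambda>i. a * c i)) n =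
      fps_nth (fps_const a * (fps_X ^ k * fibre_series e c)) n"
    by (auto simp: fibre_series_def fps_X_power_mult_nth sum_distrib_left)
qed

section \<open>Theta series and the three-term relation\<close>

text \<open>The exponent of \<open>q\<close> in the term \<open>p^(j(j-1)/2) z^j\<close> of the
  triple product series, where \<open>p = q^15\<close> and \<open>z\<close> is \<open>q^a\<close> up
  to sign.\<close>

definition theta_exp :: "int \<Rightarrow> int \<Rightarrow> nat" where
  "theta_exp a j = nat (15 * (j * (j - 1) div 2) + a * j)"

lemma triangle_double: "2 * (j * (j - 1) div 2) = j * (j - 1 :: int)"
  by (simp add: dvd_mult_div_cancel)

text \<open>For these \<open>a\<close> the argument of \<open>nat\<close> is never negative.
  Doubling removes \<open>div\<close>.\<close>

lemma int_theta_exp: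
  assumes "0 \<le> a" "a \<le> 15"
  shows "2 * int (theta_exp a j) = 15 * (j * (j - 1)) + 2 * (a * j)"
proof -
  have "0 \<le> 15 * (j * (j - 1)) + 2 * (a * j)"
  proof (cases "j \<ge> 0")
    case True
    have "0 \<le> j * (j - 1)" using True by (cases "j = 0") auto
    then show ?thesis using True assms by simp
  next
    case False
    have "0 \<le> (- j) * (15 * (1 - j) - 2 * a)"
      using False assms by (intro mult_nonneg_nonneg) auto
    then show ?thesis by (simp add: algebra_simps)
  qed
  then have "0 \<le> 15 * (j * (j - 1) div 2) + a * j"
    using triangle_double[of j] by linarith
  then have "int (theta_exp a j) = 15 * (j * (j - 1) div 2) + a * j"
    by (simp add: theta_exp_def)
  then show ?thesis using triangle_double[of j] by linarith
qed

text \<open>A crude linear bound with two uses: it makes the fibres finite, and its slope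
  \<open>15\<close> balances the error terms of the truncated triple product.\<close>

lemma theta_exp_ge:
  assumes "0 \<le> a" "a \<le> 15"
  shows "15 * \<bar>j\<bar> - 30 \<le> int (theta_exp a j)"
proof (cases "j \<ge> 0")
  case True
  have "0 \<le> (j - 2) * (j - 2)" "0 \<le> a * j" using True assms by auto
  moreover have "(j - 2) * (j - 2) = j * (j - 1) - 3 * j + 4" by (simp add: algebra_simps)
  ultimately show ?thesis using int_theta_exp[OF assms, of j] True by simp
next
  case False
  define P where "P = j * (j - 1)"
  define R where "R = a * j"
  have "0 \<le> (15 - a) * (- j)" using False assms by (intro mult_nonneg_nonneg) auto
  then have R: "R \<ge> 15 * j" by (simp add: R_def algebra_simps)
  have "P = (j + 2) * (j + 2) - 5 * j - 4" by (simp add: P_def algebra_simps)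
  then have "P \<ge> - (5 * j) - 4" using zero_le_square[of "j + 2"] by linarith
  moreover have "2 * int (theta_exp a j) = 15 * P + 2 * R"
    using int_theta_exp[OF assms, of j] by (simp add: P_def R_def)
  ultimately show ?thesis using R False by linarith
qed

lemma finite_fibre_if_abs_bound:
  fixes e :: "int \<Rightarrow> nat"
  assumes "\<And>j. 15 * \<bar>j\<bar> - 30 \<le> int (e j)"
  shows "finite {j. e j = n}"
proof (rule finite_subset)
  show "{j. e j = n} \<subseteq> {- (int n + 2)..int n + 2}"
  proof
    fix j assume "j \<in> {j. e j = n}"
    then show "j \<in> {- (int n + 2)..int n + 2}" using assms[of j] by auto
  qed
qed auto

text \<open>For \<open>t = 1\<close> and \<open>t = -1\<close> the coefficient is the integer power
  \<open>t^j\<close>. By the triple product the series is \<theta>(-t q^a) times the infinite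
  product of the \<open>1 - p^k\<close>.\<close>

definition theta_series :: "int \<Rightarrow> int \<Rightarrow> int fps" where
  "theta_series t a = fibre_series (theta_exp a) (\<lambda>j. t ^ nat \<bar>j\<bar>)"

text \<open>\<open>even_exp\<close> and \<open>odd_exp\<close> are the one-variable exponents, of
  theta type in base \<open>q^30\<close>, into which the exponent of a product of two theta series
  separates.\<close>

definition even_exp :: "int \<Rightarrow> int \<Rightarrow> nat" where
  "even_exp a j = nat (15 * (j * (j - 1)) + 2 * a * j)"

definition odd_exp :: "int \<Rightarrow> int \<Rightarrow> nat" where
  "odd_exp a j = nat (15 * (j * j) + 2 * a * j)"

definition even_part :: "int \<Rightarrow> int fps" where
  "even_part a = fibre_series (even_exp a) (\<lambda>_. 1)"

definition odd_part :: "int \<Rightarrow> int fps" where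
  "odd_part a = fibre_series (odd_exp a) (\<lambda>_. 1)"

lemma int_even_exp:
  assumes "0 \<le> a" "a \<le> 7"
  shows "int (even_exp a j) = 15 * (j * (j - 1)) + 2 * a * j"
proof -
  have "0 \<le> 15 * (j * (j - 1)) + 2 * a * j"
  proof (cases "j \<ge> 0")
    case True
    have "0 \<le> j * (j - 1)" using True by (cases "j = 0") auto
    then show ?thesis using True assms by simp
  next
    case False
    have "0 \<le> (- j) * (15 * (1 - j) - 2 * a)"
      using False assms by (intro mult_nonneg_nonneg) auto
    then show ?thesis by (simp add: algebra_simps)
  qed
  then show ?thesis by (simp add: even_exp_def)
qed

text \<open>Since \<open>2 * a \<le> 14\<close>, the square term dominates the linear one and
  \<open>nat\<close> truncates nothing.\<close>

lemma int_odd_exp: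
  assumes "0 \<le> a" "a \<le> 7"
  shows "int (odd_exp a j) = 15 * (j * j) + 2 * a * j"
proof -
  have "0 \<le> 15 * (j * j) + 2 * a * j"
  proof (cases "j \<ge> 0")
    case True
    then show ?thesis using assms by simp
  next
    case False
    have "0 \<le> (- j) * (15 * (- j) - 2 * a)"
      using False assms by (intro mult_nonneg_nonneg) auto
    then show ?thesis by (simp add: algebra_simps)
  qed
  then show ?thesis by (simp add: odd_exp_def)
qed

lemma finite_theta_exp: "0 \<le> a \<Longrightarrow> a \<le> 15 \<Longrightarrow> finite {j. theta_exp a j = n}"
  by (rule finite_fibre_if_abs_bound) (rule theta_exp_ge)

lemma finite_even_exp:
  assumes "0 \<le> a" "a \<le> 7"
  shows "finite {j. even_exp a j = n}"
proof (rule finite_fibre_if_abs_bound)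
  fix j :: int
  \<comment> \<open>The parameter \<open>2 * a\<close> gives the same linear term; the two exponents
    then differ by half of \<open>15 * (j * (j - 1))\<close>.\<close>
  have 1: "15 * \<bar>j\<bar> - 30 \<le> int (theta_exp (2 * a) j)"
    using assms by (intro theta_exp_ge) auto
  have "0 \<le> j * (j - 1)"
    by (cases "j \<le> 0") (auto intro: mult_nonneg_nonneg mult_nonpos_nonpos)
  then have "int (theta_exp (2 * a) j) \<le> int (even_exp a j)"
    using int_theta_exp[of "2 * a" j] int_even_exp[of a j] assms by (simp add: mult.assoc)
  with 1 show "15 * \<bar>j\<bar> - 30 \<le> int (even_exp a j)" by linarith
qed

lemma finite_odd_exp:
  assumes "0 \<le> a" "a \<le> 7"
  shows "finite {j. odd_exp a j = n}"
proof (rule finite_fibre_if_abs_bound)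
  fix j :: int
  \<comment> \<open>The resulting bound \<open>j * j \<ge> 2 |j| - 1\<close> makes the exponent at
    least \<open>16 |j| - 15\<close>.\<close>
  have "0 \<le> (\<bar>j\<bar> - 1) * (\<bar>j\<bar> - 1)" by (rule zero_le_square)
  also have "(\<bar>j\<bar> - 1) * (\<bar>j\<bar> - 1) = j * j - 2 * \<bar>j\<bar> + 1" by (simp add: algebra_simps)
  finally have "2 * \<bar>j\<bar> - 1 \<le> j * j" by simp
  moreover have "- (14 * \<bar>j\<bar>) \<le> 2 * a * j"
  proof (cases "j \<ge> 0")
    case True
    then have "0 \<le> 2 * a * j" using assms by simp
    then show ?thesis using True by linarith
  next
    case False
    then have "a * (- j) \<le> 7 * (- j)" using assms by (intro mult_right_mono) auto
    then show ?thesis using False by (simp add: algebra_simps)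
  qed
  ultimately show "15 * \<bar>j\<bar> - 30 \<le> int (odd_exp a j)"
    using int_odd_exp[OF assms, of j] by linarith
qed

lemma sign_power:
  assumes "t = 1 \<or> t = (-1::int)"
  shows "t ^ nat \<bar>m\<bar> * t ^ nat \<bar>n\<bar> = (if even (m + n) then 1 else t)"
  using assms by (auto simp: minus_one_power_iff even_nat_iff simp flip: power_add)

text \<open>
  The substitution \<open>(m, n) = (s + d, s - d)\<close>, or \<open>(s + d, s - d + 1)\<close> when \<open>m + n\<close> is odd,
  separates the variables in the double sum.
\<close>

lemma theta_series_mult:
  assumes t: "t = 1 \<or> t = -1" and ab: "0 \<le> b" "b \<le> a" "a \<le> 7" "a + b \<le> 15"
  shows "theta_series t (a + b) * theta_series t (a - b) =
    even_part a * odd_part b + fps_const t * (fps_X ^ nat (a - b) * (odd_part a * even_part b))"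
proof -
  define f :: "int \<times> int \<Rightarrow> int \<times> int" where "f = (\<lambda>(s, d). (s + d, s - d))"
  define g :: "int \<times> int \<Rightarrow> int \<times> int" where "g = (\<lambda>(s, d). (s + d, s - d + 1))"
  define e where "e = (\<lambda>(i, j). theta_exp (a + b) i + theta_exp (a - b) j)"
  define c :: "int \<times> int \<Rightarrow> int" where "c = (\<lambda>(i, j). t ^ nat \<bar>i\<bar> * t ^ nat \<bar>j\<bar>)"
  have fin1: "finite {j. theta_exp (a + b) j = n}" "finite {j. theta_exp (a - b) j = n}" for n
    using ab by (auto intro!: finite_theta_exp)
  have "finite {z. e z = n}" for n
  proof (rule finite_subset)
    show "{z. e z = n} \<subseteq> (\<Union>k\<le>n. {i. theta_exp (a + b) i = k}) \<times> (\<Union>k\<le>n. {j. theta_exp (a - b) j = k})"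
      by (auto simp: e_def)
  qed (use fin1 in auto)
  moreover have "inj f" "inj g" by (auto simp: inj_def f_def g_def)
  moreover have "range f \<inter> range g = {}"
  proof -
    \<comment> \<open>The sum of the coordinates is even on the range of \<open>f\<close> and odd on
      that of \<open>g\<close>.\<close>
    have "f z \<noteq> g z'" for z z'
      unfolding f_def g_def by (cases z; cases z') (simp, presburger)
    then show ?thesis by (metis (no_types) disjoint_iff imageE)
  qed
  moreover have "range f \<union> range g = UNIV"
  proof -
    have "(m, n) \<in> range f \<union> range g" for m n
    proof (cases "even (m + n)")
      case True
      then have "(m, n) = f ((m + n) div 2, (m - n) div 2)" unfolding f_def by simp presburger
      then show ?thesis by blast
    next
      case False
      then have "(m, n) = g ((m + n) div 2, (m - n + 1) div 2)" unfolding g_def by simp presburger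
      then show ?thesis by blast
    qed
    then show ?thesis by fast
  qed
  ultimately have "fibre_series e c = fibre_series (e \<circ> f) (c \<circ> f) + fibre_series (e \<circ> g) (c \<circ> g)"
    by (intro fibre_series_split)
  moreover have "e \<circ> f = (\<lambda>(s, d). even_exp a s + odd_exp b d)"
  proof (rule ext, clarify)
    fix s d
    have "2 * int (e (f (s, d))) = 2 * int (even_exp a s + odd_exp b d)"
      using ab by (simp add: e_def f_def int_theta_exp int_even_exp int_odd_exp distrib_left)
        (simp add: algebra_simps)
    then show "(e \<circ> f) (s, d) = even_exp a s + odd_exp b d" by simp
  qed
  \<comment> \<open>The offset \<open>a - b\<close> is the exponent at \<open>s = d = 0\<close>,
    where \<open>g\<close> gives \<open>(0, 1)\<close>.\<close>
  moreover have "e \<circ> g = (\<lambda>z. nat (a - b) + (case z of (s, d) \<Rightarrow> odd_exp a s + even_exp b d))"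
  proof (rule ext)
    fix z :: "int \<times> int"
    obtain s d where z: "z = (s, d)" by fastforce
    have "2 * int (e (g (s, d))) = 2 * (a - b) + 2 * int (odd_exp a s + even_exp b d)"
      using ab by (simp add: e_def g_def int_theta_exp int_even_exp int_odd_exp distrib_left algebra_simps)
    then show "(e \<circ> g) z = nat (a - b) + (case z of (s, d) \<Rightarrow> odd_exp a s + even_exp b d)"
      using ab z by simp
  qed
  moreover have "c \<circ> f = (\<lambda>(s, d). 1 * 1)" "c \<circ> g = (\<lambda>z. t * (case z of (s, d) \<Rightarrow> 1 * 1))"
    by (auto simp: fun_eq_iff c_def f_def g_def sign_power[OF t])
  moreover have "theta_series t (a + b) * theta_series t (a - b) = fibre_series e c"
    unfolding theta_series_def e_def c_def by (rule fibre_series_mult) (fact fin1)+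
  moreover have "even_part a * odd_part b = fibre_series (\<lambda>(s, d). even_exp a s + odd_exp b d) (\<lambda>(s, d). 1 * 1)"
    unfolding even_part_def odd_part_def
    using ab by (intro fibre_series_mult finite_even_exp finite_odd_exp) auto
  moreover have "odd_part a * even_part b = fibre_series (\<lambda>(s, d). odd_exp a s + even_exp b d) (\<lambda>(s, d). 1 * 1)"
    unfolding even_part_def odd_part_def
    using ab by (intro fibre_series_mult finite_even_exp finite_odd_exp) auto
  ultimately show ?thesis by (simp only: fibre_series_X_power_mult)
qed

text \<open>The six products belong to the six pairs from 0, 3, 5, 6. Up to sign and a power of
  \<open>q\<close> they are the minors of the matrix with rows
  \<open>(even_part a, q^a * odd_part a)\<close>, where the second entry is negated for
  \<open>a = 5\<close>; this negation accounts for \<open>t = 1\<close> in the pairs that contain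
  5.\<close>

lemma theta_series_three_term:
  fixes f g
  defines "f \<equiv> theta_series (-1)" and "g \<equiv> theta_series 1"
  shows "f 6 * f 6 * (g 8 * g 2) - fps_X ^ 2 * (f 3 * f 3 * (g 11 * g 1)) = f 9 * f 3 * (g 5 * g 5)"
proof -
  have m: "f 6 * f 6 = even_part 6 * odd_part 0 - fps_X ^ 6 * (odd_part 6 * even_part 0)"
    "g 8 * g 2 = even_part 5 * odd_part 3 + fps_X ^ 2 * (odd_part 5 * even_part 3)"
    "f 3 * f 3 = even_part 3 * odd_part 0 - fps_X ^ 3 * (odd_part 3 * even_part 0)"
    "g 11 * g 1 = even_part 6 * odd_part 5 + fps_X * (odd_part 6 * even_part 5)"
    "f 9 * f 3 = even_part 6 * odd_part 3 - fps_X ^ 3 * (odd_part 6 * even_part 3)"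
    "g 5 * g 5 = even_part 5 * odd_part 0 + fps_X ^ 5 * (odd_part 5 * even_part 0)"
    using theta_series_mult[of "-1" 0 6] theta_series_mult[of 1 3 5] theta_series_mult[of "-1" 0 3]
      theta_series_mult[of 1 5 6] theta_series_mult[of "-1" 3 6] theta_series_mult[of 1 0 5]
    by (simp_all add: f_def g_def flip: fps_const_neg)
  show ?thesis unfolding m by algebra
qed

section \<open>The Jacobi triple product\<close>

text \<open>The q-binomial coefficient in base \<open>p\<close>, given by Pascal's rule because a
  ring offers no quotients.\<close>

fun gauss_binomial :: "'a::comm_ring_1 \<Rightarrow> nat \<Rightarrow> nat \<Rightarrow> 'a" where
  "gauss_binomial p n 0 = 1"
| "gauss_binomial p 0 (Suc k) = 0"
| "gauss_binomial p (Suc n) (Suc k) = gauss_binomial p n k + p ^ Suc k * gauss_binomial p n (Suc k)"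

text \<open>The q-Pochhammer symbol \<open>(p; p)_n\<close>.\<close>

definition pochhammer_q :: "'a::comm_ring_1 \<Rightarrow> nat \<Rightarrow> 'a" where
  "pochhammer_q p n = (\<Prod>k<n. 1 - p ^ Suc k)"

lemma gauss_binomial_eq_0: "n < k \<Longrightarrow> gauss_binomial p n k = 0"
  by (induction p n k rule: gauss_binomial.induct) auto

text \<open>The quotient formula with denominators cleared. Pascal's rule reduces it to
  \<open>(1 - p^(k+1)) + p^(k+1) (1 - p^(n-k)) = 1 - p^(n+1)\<close>.\<close>

lemma gauss_binomial_pochhammer_q:
  "k \<le> n \<Longrightarrow> gauss_binomial p n k * (pochhammer_q p k * pochhammer_q p (n - k)) = pochhammer_q p n"
proof (induction p n k rule: gauss_binomial.induct)
  case (3 p n k)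
  have 1: "gauss_binomial p n k * (pochhammer_q p k * pochhammer_q p (n - k)) = pochhammer_q p n"
    using 3 by simp
  have 2: "gauss_binomial p n (Suc k) * (pochhammer_q p (Suc k) * pochhammer_q p (n - k)) =
      (1 - p ^ (n - k)) * pochhammer_q p n"
  \<comment> \<open>For \<open>k = n\<close> both sides vanish: the coefficient is \<open>0\<close>,
    and so is \<open>1 - p ^ 0\<close>.\<close>
  proof (cases "k < n")
    case True
    then have "n - k = Suc (n - Suc k)" by simp
    then have "pochhammer_q p (n - k) = pochhammer_q p (n - Suc k) * (1 - p ^ (n - k))"
      by (simp add: pochhammer_q_def)
    moreover have "gauss_binomial p n (Suc k) * (pochhammer_q p (Suc k) * pochhammer_q p (n - Suc k)) = pochhammer_q p n"
      using 3(2) True by simp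
    ultimately show ?thesis by (simp flip: mult.assoc)
  qed (use 3(3) in \<open>simp add: gauss_binomial_eq_0\<close>)
  have "gauss_binomial p (Suc n) (Suc k) * (pochhammer_q p (Suc k) * pochhammer_q p (Suc n - Suc k)) =
      (1 - p ^ Suc k) * (gauss_binomial p n k * (pochhammer_q p k * pochhammer_q p (n - k))) +
      p ^ Suc k * (gauss_binomial p n (Suc k) * (pochhammer_q p (Suc k) * pochhammer_q p (n - k)))"
    by (simp add: pochhammer_q_def algebra_simps)
  also have "\<dots> = (1 - p ^ Suc k * p ^ (n - k)) * pochhammer_q p n"
    unfolding 1 2 by (simp only: algebra_simps mult_1_left)
  also have "p ^ Suc k * p ^ (n - k) = p ^ Suc n"
    using 3(3) by (simp only: power_add[symmetric]) simp
  finally show ?case by (simp add: pochhammer_q_def ac_simps)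
qed (simp_all add: pochhammer_q_def)

text \<open>The homogeneous form lets \<open>w = p ^ n\<close> replace negative powers of
  \<open>p\<close>. The induction splits off the factor \<open>w + y\<close>, which turns
  \<open>y\<close> into \<open>y * p\<close> in the others.\<close>

lemma q_binomial_theorem:
  "(\<Prod>k<n. w + y * p ^ k) =
    (\<Sum>k\<le>n. gauss_binomial p n k * p ^ (k choose 2) * y ^ k * w ^ (n - k))"
proof (induction n arbitrary: y)
  case (Suc n)
  define T where "T i = gauss_binomial p n i * p ^ (i choose 2) * (y * p) ^ i * w ^ (n - i)" for i
  have choose: "Suc k choose 2 = k + (k choose 2)" for k
    by (simp add: numeral_2_eq_2)
  have zero: "0 choose 2 = 0" by (simp add: numeral_2_eq_2)
  \<comment> \<open>At \<open>k = n\<close> the subtraction \<open>n - Suc k\<close> is truncated,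
    but the coefficient is \<open>0\<close> there.\<close>
  have shift: "T (Suc k) * w =
      gauss_binomial p n (Suc k) * p ^ Suc k * p ^ (Suc k choose 2) * y ^ Suc k * w ^ (n - k)" if "k \<le> n" for k
  proof (cases "k = n")
    case False
    then have "w ^ (n - k) = w * w ^ (n - Suc k)" using that
      by (metis Suc_diff_Suc le_neq_implies_less power_Suc)
    then show ?thesis by (simp add: T_def power_mult_distrib ac_simps)
  qed (simp add: T_def gauss_binomial_eq_0)
  have T0: "T 0 = w ^ n" by (simp add: T_def zero)
  have "(\<Prod>k<Suc n. w + y * p ^ k) = (w + y) * (\<Prod>k<n. w + (y * p) * p ^ k)"
    by (simp add: prod.lessThan_Suc_shift mult.assoc del: prod.lessThan_Suc)
  also have "\<dots> = y * (\<Sum>k\<le>n. T k) + w * (\<Sum>k\<le>Suc n. T k)"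
    unfolding Suc.IH T_def by (simp add: gauss_binomial_eq_0 algebra_simps)
  also have "\<dots> = w ^ Suc n + (\<Sum>k\<le>n. y * T k + T (Suc k) * w)"
    by (simp add: sum.atMost_Suc_shift sum_distrib_left sum.distrib T0 algebra_simps del: sum.atMost_Suc)
  also have "(\<Sum>k\<le>n. y * T k + T (Suc k) * w) =
      (\<Sum>k\<le>n. gauss_binomial p (Suc n) (Suc k) * p ^ (Suc k choose 2) * y ^ Suc k * w ^ (n - k))"
  proof (rule sum.cong[OF refl])
    fix k assume "k \<in> {..n}"
    then show "y * T k + T (Suc k) * w =
        gauss_binomial p (Suc n) (Suc k) * p ^ (Suc k choose 2) * y ^ Suc k * w ^ (n - k)"
      by (simp only: shift atMost_iff)
        (simp add: T_def choose power_add power_mult_distrib algebra_simps)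
  qed
  also have "w ^ Suc n + \<dots> =
      (\<Sum>k\<le>Suc n. gauss_binomial p (Suc n) k * p ^ (k choose 2) * y ^ k * w ^ (Suc n - k))"
    by (simp add: sum.atMost_Suc_shift zero del: sum.atMost_Suc gauss_binomial.simps(3) power_Suc)
  finally show ?case .
qed (simp add: numeral_2_eq_2)

lemma prod_lessThan_add:
  "(\<Prod>k<m + n. f k) = (\<Prod>k<m. f k) * (\<Prod>k<n. f (m + k :: nat))"
  by (induction n) (simp_all add: ac_simps)

lemma prod_power_lessThan: "(\<Prod>k<n. p ^ k) = (p :: 'a::comm_monoid_mult) ^ (n choose 2)"
  by (induction n) (simp_all add: numeral_2_eq_2 power_add ac_simps)

text \<open>For \<open>t = -1\<close> and \<open>t = 1\<close> this truncates \<open>\<theta>(q^a)\<close> and \<open>\<theta>(-q^a)\<close>, respectively.\<close>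

definition theta_prod :: "int \<Rightarrow> nat \<Rightarrow> nat \<Rightarrow> int fps" where
  "theta_prod t a n = (\<Prod>k<n. (1 + fps_const t * fps_X ^ (15 * k + a)) *
    (1 + fps_const t * fps_X ^ (15 * k + (15 - a))))"

lemma int_choose_2: "2 * int (k choose 2) = int k * (int k - 1)"
  by (induction k) (simp_all add: numeral_2_eq_2 algebra_simps)

text \<open>A finite Jacobi triple product: \<open>q_binomial_theorem\<close> with
  \<open>2 * n\<close> factors, \<open>w = p ^ n\<close> and \<open>y = t q^a\<close>. The first
  \<open>n\<close> factors yield those of \<open>theta_prod\<close> with \<open>15 - a\<close>, the
  last \<open>n\<close> those with \<open>a\<close>; cancelling a common monomial recentres the sum
  at \<open>k = n\<close>.\<close>

lemma theta_prod_eq_sum: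
  assumes t: "t = 1 \<or> t = -1" and a: "a \<le> 15"
  shows "theta_prod t a n = (\<Sum>k\<le>2 * n. gauss_binomial (fps_X ^ 15) (2 * n) k *
    (fps_const (t ^ nat \<bar>int k - int n\<bar>) * fps_X ^ theta_exp (int a) (int k - int n)))"
    (is "_ = (\<Sum>k\<le>2 * n. ?b k * ?c k)")
proof -
  define X where "X = (fps_X :: int fps)"
  define T where "T = (fps_const t :: int fps)"
  define p where "p = X ^ 15"
  \<comment> \<open>The total exponent of the monomials pulled out: \<open>q^a p^k\<close> for each
    \<open>k < n\<close> from the first half, and \<open>p ^ n\<close> from each of the last
    \<open>n\<close> factors.\<close>
  define e where "e = a * n + 15 * ((n choose 2) + n * n)"
  have TT: "T * T = 1" using t by (auto simp: T_def)
  \<comment> \<open>As \<open>T\<close> is its own inverse, pulling out \<open>T * Z * P\<close>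
    leaves \<open>T * Y\<close> beside the \<open>1\<close>.\<close>
  have factor_out: "Q + T * Z * P = T * Z * P * (1 + T * Y)" if "Z * P * Y = Q" for Q Z P Y
  proof -
    have "T * Z * P * (1 + T * Y) = T * Z * P + (T * T) * (Z * P * Y)"
      by (simp add: algebra_simps)
    then show ?thesis using that TT by simp
  qed
  have "(\<Prod>k<2 * n. p ^ n + (T * X ^ a) * p ^ k) =
      (\<Prod>k<n. p ^ n + (T * X ^ a) * p ^ k) * (\<Prod>k<n. p ^ n + (T * X ^ a) * p ^ (n + k))"
    unfolding mult_2 by (rule prod_lessThan_add)
  also have "(\<Prod>k<n. p ^ n + (T * X ^ a) * p ^ k) =
      (\<Prod>k<n. (T * X ^ a * p ^ k) * (1 + T * X ^ (15 * (n - Suc k) + (15 - a))))"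
  proof (rule prod.cong[OF refl])
    fix k assume k: "k \<in> {..<n}"
    have "X ^ a * p ^ k * X ^ (15 * (n - Suc k) + (15 - a)) = X ^ (a + 15 * k + (15 * (n - Suc k) + (15 - a)))"
      by (simp add: p_def power_add flip: power_mult)
    also have "a + 15 * k + (15 * (n - Suc k) + (15 - a)) = 15 * n" using k a by auto
    finally have "X ^ a * p ^ k * X ^ (15 * (n - Suc k) + (15 - a)) = p ^ n" by (simp add: p_def power_mult)
    then show "p ^ n + (T * X ^ a) * p ^ k = (T * X ^ a * p ^ k) * (1 + T * X ^ (15 * (n - Suc k) + (15 - a)))"
      by (rule factor_out)
  qed
  also have "\<dots> = (\<Prod>k<n. T * X ^ a * p ^ k) * (\<Prod>k<n. 1 + T * X ^ (15 * k + (15 - a)))"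
    by (simp add: prod.distrib prod.nat_diff_reindex[of "\<lambda>k. 1 + T * X ^ (15 * k + (15 - a))" n])
  also have "(\<Prod>k<n. p ^ n + (T * X ^ a) * p ^ (n + k)) = (\<Prod>k<n. p ^ n * (1 + T * X ^ (15 * k + a)))"
    by (intro prod.cong) (simp_all add: p_def power_add algebra_simps flip: power_mult)
  also have "(\<Prod>k<n. T * X ^ a * p ^ k) * (\<Prod>k<n. 1 + T * X ^ (15 * k + (15 - a))) * \<dots> =
      ((\<Prod>k<n. T * X ^ a * p ^ k) * (p ^ n) ^ n) * theta_prod t a n"
    by (simp add: theta_prod_def prod.distrib T_def X_def ac_simps)
  also have "(\<Prod>k<n. T * X ^ a * p ^ k) = (T * X ^ a) ^ n * p ^ (n choose 2)"
    by (simp add: prod.distrib prod_power_lessThan)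
  also have "(T * X ^ a) ^ n * p ^ (n choose 2) * (p ^ n) ^ n = T ^ n * X ^ e"
    by (simp add: power_mult_distrib p_def e_def power_add add_mult_distrib2 mult.assoc flip: power_mult)
  finally have prod: "(\<Prod>k<2 * n. p ^ n + (T * X ^ a) * p ^ k) = T ^ n * X ^ e * theta_prod t a n" .
  have reorder: "b * P * (U * Z) * W = V * R * (b * (C * S))" if "P * Z * W = R * S" "U = V * C"
    for b P U Z W V R C S :: "int fps"
  proof -
    have "b * P * (U * Z) * W = b * U * (P * Z * W)" by (simp add: ac_simps)
    then show ?thesis using that by (simp add: ac_simps)
  qed
  have "T ^ n * X ^ e * theta_prod t a n =
      (\<Sum>k\<le>2 * n. gauss_binomial p (2 * n) k * p ^ (k choose 2) * (T * X ^ a) ^ k * (p ^ n) ^ (2 * n - k))"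
    unfolding prod[symmetric] by (rule q_binomial_theorem)
  also have "\<dots> = (\<Sum>k\<le>2 * n. T ^ n * X ^ e * (?b k * ?c k))"
  proof (rule sum.cong[OF refl])
    fix k assume k: "k \<in> {..2 * n}"
    define E where "E = theta_exp (int a) (int k - int n)"
    have pow: "(T * X ^ a) ^ k = T ^ k * X ^ (a * k)"
      by (simp add: power_mult_distrib power_mult)
    define l where "l = 2 * n - k"
    have l: "int l = 2 * int n - int k" using k by (simp add: l_def of_nat_diff)
    have "2 * int (15 * (k choose 2) + a * k + 15 * (n * l)) = 2 * int (e + E)"
      using k a int_choose_2[of k] int_choose_2[of n] int_theta_exp[of "int a" "int k - int n"]
      by (simp add: e_def E_def l algebra_simps)
    then have "15 * (k choose 2) + a * k + 15 * (n * l) = e + E"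
      by (simp del: of_nat_add of_nat_mult)
    then have "p ^ (k choose 2) * X ^ (a * k) * (p ^ n) ^ l = X ^ e * X ^ E"
      by (simp add: p_def flip: power_mult power_add) (simp add: mult.assoc)
    moreover have "T ^ k = T ^ n * fps_const (t ^ nat \<bar>int k - int n\<bar>)"
      using t by (auto simp: T_def fps_const_power fps_const_mult minus_one_power_iff even_nat_iff)
    ultimately show "gauss_binomial p (2 * n) k * p ^ (k choose 2) * (T * X ^ a) ^ k * (p ^ n) ^ (2 * n - k) =
        T ^ n * X ^ e * (?b k * ?c k)"
      unfolding E_def[symmetric] X_def[symmetric] p_def[symmetric] pow l_def[symmetric] by (rule reorder)
  qed
  also have "\<dots> = T ^ n * X ^ e * (\<Sum>k\<le>2 * n. ?b k * ?c k)" by (simp add: sum_distrib_left)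
  finally have "T ^ n * X ^ e * theta_prod t a n = T ^ n * X ^ e * (\<Sum>k\<le>2 * n. ?b k * ?c k)" .
  moreover have nz: "T ^ n * X ^ e \<noteq> 0" using t by (auto simp: T_def X_def fps_const_power)
  ultimately show ?thesis unfolding mult_left_cancel[OF nz] by blast
qed

section \<open>Error estimates and the passage to the theta series\<close>

lemma pochhammer_q_nth_0:
  "0 < r \<Longrightarrow> fps_nth (pochhammer_q (fps_X ^ r) n) 0 = (1::'a::comm_ring_1)"
proof (induction n)
  case (Suc n)
  have "fps_nth ((fps_X ^ r :: 'a fps) ^ Suc n) 0 = 0"
    using Suc.prems by (simp only: fps_X_power_nth power_mult[symmetric]) simp
  then show ?case
    using Suc by (simp add: pochhammer_q_def fps_mult_nth_0 del: power_Suc)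
qed (simp add: pochhammer_q_def)

lemma pochhammer_q_cong:
  assumes "m \<le> n"
  shows "fps_cong (r * Suc m) (pochhammer_q (fps_X ^ r) n :: 'a::comm_ring_1 fps) (pochhammer_q (fps_X ^ r) m)"
  using assms
proof (induction n rule: dec_induct)
  case (step n)
  have "fps_cong (r * Suc m) (1 - (fps_X ^ r) ^ Suc n :: 'a fps) 1"
    unfolding power_mult[symmetric] using step by (intro fps_cong_one_minus_X_power mult_le_mono2) simp
  from fps_cong_mult[OF step.IH this] show ?case by (simp add: pochhammer_q_def)
qed simp

text \<open>Since \<open>m\<close> is at most \<open>k\<close>, \<open>2 * n - k\<close> and
  \<open>n\<close>, each Pochhammer symbol in the quotient formula may be replaced by
  \<open>P m\<close>. Hence \<open>P m * (P m * b)\<close> is congruent to \<open>P m\<close>, and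
  one \<open>P m\<close> cancels.\<close>

lemma gauss_binomial_cong:
  assumes "m \<le> k" "m + k \<le> 2 * n" "0 < r"
  shows "fps_cong (r * Suc m) (pochhammer_q (fps_X ^ r) n * gauss_binomial (fps_X ^ r) (2 * n) k) (1 :: 'a::comm_ring_1 fps)"
proof -
  define P where "P n = (pochhammer_q (fps_X ^ r) n :: 'a fps)" for n
  define b where "b = (gauss_binomial (fps_X ^ r) (2 * n) k :: 'a fps)"
  have P: "fps_cong (r * Suc m) (P l) (P m)" if "m \<le> l" for l
    unfolding P_def using that by (rule pochhammer_q_cong)
  have "P m * (P m * b) = b * (P m * P m)" by (simp only: ac_simps)
  also have "fps_cong (r * Suc m) \<dots> (b * (P k * P (2 * n - k)))"
    using assms by (intro fps_cong_mult fps_cong_refl P[THEN fps_cong_sym]) auto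
  also have "b * (P k * P (2 * n - k)) = P (2 * n)"
    unfolding b_def P_def using assms by (intro gauss_binomial_pochhammer_q) simp
  also have "fps_cong (r * Suc m) (P (2 * n)) (P m * 1)"
    unfolding mult_1_right using assms by (intro P) simp
  finally have "fps_cong (r * Suc m) (P m * b) 1"
    by (rule fps_cong_mult_cancel) (simp add: P_def pochhammer_q_nth_0 assms)
  with _ have "fps_cong (r * Suc m) (P n * b) 1"
  proof (rule fps_cong_trans)
    show "fps_cong (r * Suc m) (P n * b) (P m * b)"
      using assms by (intro fps_cong_mult fps_cong_refl P) auto
  qed
  then show ?thesis unfolding P_def b_def .
qed

text \<open>The triple product with an explicit error. The coefficient at \<open>j\<close> is
  \<open>1\<close> up to order \<open>15 (n - |j| + 1)\<close>, its monomial adds at least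
  \<open>15 |j| - 30\<close>, and these sum to \<open>15 n - 15\<close> whatever \<open>j\<close>
  is.\<close>

lemma theta_prod_cong:
  assumes t: "t = 1 \<or> t = -1" and a: "a \<le> 15"
  shows "fps_cong (15 * n - 15) (pochhammer_q (fps_X ^ 15) n * theta_prod t a n) (theta_series t (int a))"
proof -
  define c where "c j = fps_const (t ^ nat \<bar>j\<bar>) * fps_X ^ theta_exp (int a) j" for j
  have bound: "15 * \<bar>j\<bar> - 30 \<le> int (theta_exp (int a) j)" for j
    using a by (intro theta_exp_ge) auto
  have "pochhammer_q (fps_X ^ 15) n * theta_prod t a n = (\<Sum>k\<le>2 * n.
      c (int k - int n) * (pochhammer_q (fps_X ^ 15) n * gauss_binomial (fps_X ^ 15) (2 * n) k))"
    unfolding theta_prod_eq_sum[OF t a] c_def by (simp add: sum_distrib_left ac_simps)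
  also have "fps_cong (15 * n - 15) \<dots> (\<Sum>k\<le>2 * n. c (int k - int n) * 1)"
  proof (rule fps_cong_sum)
    fix k assume "k \<in> {..2 * n}"
    then have k: "k \<le> 2 * n" by simp
    define j where "j = int k - int n"
    \<comment> \<open>The distance from \<open>k\<close> to the nearer end of the range
      \<open>0, ..., 2 * n\<close>.\<close>
    define m where "m = min k (2 * n - k)"
    have m: "int m = int n - \<bar>j\<bar>" using k by (auto simp: m_def j_def)
    let ?g = "pochhammer_q (fps_X ^ 15) n * gauss_binomial (fps_X ^ 15) (2 * n) k :: int fps"
    have "fps_cong (15 * Suc m) ?g 1"
      using k by (intro gauss_binomial_cong) (auto simp: m_def)
    then have "fps_cong (15 * Suc m + theta_exp (int a) j) (fps_X ^ theta_exp (int a) j * ?g) (fps_X ^ theta_exp (int a) j * 1)"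
      by (rule fps_cong_X_power_mult)
    moreover have "15 * n - 15 \<le> 15 * Suc m + theta_exp (int a) j"
      unfolding mult_Suc_right using bound[of j] m by linarith
    ultimately have "fps_cong (15 * n - 15) (fps_X ^ theta_exp (int a) j * ?g) (fps_X ^ theta_exp (int a) j * 1)"
      by (rule fps_cong_mono)
    from fps_cong_mult[OF fps_cong_refl[of _ "fps_const (t ^ nat \<bar>j\<bar>)"] this]
    show "fps_cong (15 * n - 15) (c (int k - int n) * ?g) (c (int k - int n) * 1)"
      by (simp add: c_def j_def mult.assoc)
  qed
  also have "fps_cong (15 * n - 15) (\<Sum>k\<le>2 * n. c (int k - int n) * 1) (theta_series t (int a))"
    unfolding fps_cong_iff
  proof safe
    fix i assume i: "i < 15 * n - 15"
    \<comment> \<open>By the linear bound, all terms of degree below \<open>15 * n - 15\<close>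
      already lie in the truncated range.\<close>
    have sub: "{j. theta_exp (int a) j = i} \<subseteq> {- int n..int n}"
    proof
      fix j assume "j \<in> {j. theta_exp (int a) j = i}"
      then show "j \<in> {- int n..int n}" using bound[of j] i by auto
    qed
    have "fps_nth (\<Sum>k\<le>2 * n. c (int k - int n) * 1) i =
        (\<Sum>k\<le>2 * n. if theta_exp (int a) (int k - int n) = i then t ^ nat \<bar>int k - int n\<bar> else 0)"
      by (auto simp: fps_sum_nth c_def intro!: sum.cong)
    also have "\<dots> = (\<Sum>j\<in>{- int n..int n}. if theta_exp (int a) j = i then t ^ nat \<bar>j\<bar> else 0)"
      by (rule sum.reindex_bij_witness[of _ "\<lambda>j. nat (j + int n)" "\<lambda>k. int k - int n"]) auto
    also have "\<dots> = (\<Sum>j | theta_exp (int a) j = i. t ^ nat \<bar>j\<bar>)"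
      using sub by (intro sum.mono_neutral_cong_right) auto
    finally show "fps_nth (\<Sum>k\<le>2 * n. c (int k - int n) * 1) i = fps_nth (theta_series t (int a)) i"
      by (simp add: theta_series_def fibre_series_def)
  qed
  finally show ?thesis .
qed

section \<open>Generating functions of colored partitions\<close>

text \<open>An explicit set of colored parts allows the generating function to be built one colored
  part at a time.\<close>

definition partitions_over :: "(nat \<times> 'c) set \<Rightarrow> nat \<Rightarrow> (nat \<times> 'c) multiset set" where
  "partitions_over S n = {M. set_mset M \<subseteq> S \<and> (\<Sum>(k, i)\<in>#M. k) = n}"

text \<open>A partition that uses \<open>(k, i)\<close> loses one copy of it. Further copies may
  remain, so \<open>(k, i)\<close> stays available on the right.\<close>

lemma partitions_over_insert:
  "partitions_over (insert (k, i) S) n =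
    partitions_over S n \<union> (if k \<le> n then add_mset (k, i) ` partitions_over (insert (k, i) S) (n - k) else {})"
    (is "?L = ?R")
proof
  show "?L \<subseteq> ?R"
  proof
    fix M assume M: "M \<in> ?L"
    show "M \<in> ?R"
    proof (cases "(k, i) \<in># M")
      case True
      then obtain M' where M': "M = add_mset (k, i) M'" by (metis multi_member_split)
      with M have "M' \<in> partitions_over (insert (k, i) S) (n - k)" "k \<le> n"
        by (auto simp: partitions_over_def)
      then show ?thesis using M' by auto
    qed (use M in \<open>auto simp: partitions_over_def\<close>)
  qed
qed (auto simp: partitions_over_def split: if_splits)

lemma fps_partitions_over:
  fixes S :: "(nat \<times> 'c) set"
  assumes "finite S" and fin: "\<And>n. finite (partitions_over S n)"
  shows "Abs_fps (\<lambda>n. int (card (partitions_over S n))) * (\<Prod>(k, i)\<in>S. 1 - fps_X ^ k) = 1"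
  using assms
proof (induction S rule: finite_induct)
  case empty
  have "partitions_over ({} :: (nat \<times> 'c) set) n = (if n = 0 then {{#}} else {})" for n
    by (auto simp: partitions_over_def)
  then show ?case by (auto intro!: fps_ext)
next
  case (insert x S)
  obtain k i where x: "x = (k, i)" by (cases x)
  have sub: "partitions_over S n \<subseteq> partitions_over (insert x S) n" for n
    by (auto simp: partitions_over_def)
  have finS: "finite (partitions_over S n)" for n
    using insert.prems[of n] sub by (rule finite_subset[rotated])
  have card: "card (partitions_over (insert x S) n) = card (partitions_over S n) +
      (if k \<le> n then card (partitions_over (insert x S) (n - k)) else 0)" for n
  proof (cases "k \<le> n")
    case True
    let ?A = "add_mset x ` partitions_over (insert x S) (n - k)"
    have "card (partitions_over (insert x S) n) = card (partitions_over S n \<union> ?A)"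
      unfolding x by (subst partitions_over_insert) (simp only: True if_True)
    also have "\<dots> = card (partitions_over S n) + card ?A"
    proof (rule card_Un_disjoint)
      show "partitions_over S n \<inter> ?A = {}"
      proof -
        have "x \<notin># M" if "M \<in> partitions_over S n" for M
          using that insert.hyps(2) unfolding partitions_over_def by blast
        then show ?thesis by fastforce
      qed
    qed (use finS insert.prems in auto)
    also have "card ?A = card (partitions_over (insert x S) (n - k))"
      by (rule card_image) (simp add: inj_on_def)
    finally show ?thesis using True by simp
  next
    case False
    then have "partitions_over (insert x S) n = partitions_over S n"
      unfolding x by (subst partitions_over_insert) simp
    then show ?thesis using False by simp
  qed
  \<comment> \<open>The recurrence for \<open>card\<close>, read as an identity of series.\<close>
  have "Abs_fps (\<lambda>n. int (card (partitions_over (insert x S) n))) * (1 - fps_X ^ k) =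
      Abs_fps (\<lambda>n. int (card (partitions_over S n)))"
    by (rule fps_ext) (use card in \<open>auto simp: algebra_simps fps_X_power_mult_nth\<close>)
  then show ?case
    using insert.IH[OF finS] insert.hyps by (simp add: x mult.assoc[symmetric])
qed

text \<open>A partition of a number up to \<open>n\<close> has no part above \<open>n\<close>, so a
  finite set of colored parts determines the coefficients up to \<open>n\<close>.\<close>

lemma fps_colored_partitions:
  fixes c :: "nat \<Rightarrow> nat"
  shows "fps_cong (Suc n) (Abs_fps (\<lambda>n. int (card (colored_partitions c n))) * (\<Prod>k=1..n. (1 - fps_X ^ k) ^ c k)) 1"
proof -
  define S where "S = (SIGMA k:{1..n}. {..<c k})"
  have S: "partitions_over S m \<subseteq> colored_partitions c m" for m
    by (auto simp: partitions_over_def colored_partitions_def S_def)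
  have "colored_partitions c m = partitions_over S m" if "m \<le> n" for m
  proof
    show "colored_partitions c m \<subseteq> partitions_over S m"
    proof
      fix M assume M: "M \<in> colored_partitions c m"
      have "k \<le> m" if "(k, i) \<in># M" for k i
      proof -
        from that obtain M' where "M = add_mset (k, i) M'" by (metis multi_member_split)
        then show ?thesis using M by (auto simp: colored_partitions_def)
      qed
      then show "M \<in> partitions_over S m"
        using M that by (fastforce simp: colored_partitions_def partitions_over_def S_def)
    qed
  qed (rule S)
  then have cong: "fps_cong (Suc n) (Abs_fps (\<lambda>n. int (card (colored_partitions c n))))
      (Abs_fps (\<lambda>n. int (card (partitions_over S n))))"
    by (simp add: fps_cong_iff)
  have one: "Abs_fps (\<lambda>n. int (card (partitions_over S n))) * (\<Prod>(k, i)\<in>S. 1 - fps_X ^ k) = 1"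
    by (rule fps_partitions_over)
      (simp add: S_def, rule finite_subset[OF S finite_colored_partitions])
  have prod: "(\<Prod>(k, i)\<in>S. 1 - fps_X ^ k) = (\<Prod>k=1..n. (1 - fps_X ^ k :: int fps) ^ c k)"
    by (simp add: S_def prod.Sigma[symmetric])
  show ?thesis
    using fps_cong_mult[OF cong fps_cong_refl] one by (metis prod)
qed

section \<open>The theta product identity\<close>

text \<open>The first \<open>n\<close> pairs of factors of \<open>J a\<close>.\<close>

definition theta30 :: "nat \<Rightarrow> nat \<Rightarrow> int fps" where
  "theta30 n a = (\<Prod>k<n. (1 - fps_X ^ (30 * k + a)) * (1 - fps_X ^ (30 * k + (30 - a))))"

lemma theta30_cong:
  assumes "m \<le> n"
  shows "fps_cong (30 * m) (theta30 n a) (theta30 m a)"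
  using assms
proof (induction n rule: dec_induct)
  case (step n)
  have "fps_cong (30 * m) ((1 - fps_X ^ (30 * n + a)) * (1 - fps_X ^ (30 * n + (30 - a))) :: int fps) (1 * 1)"
    using step by (intro fps_cong_mult fps_cong_one_minus_X_power) auto
  from fps_cong_mult[OF step.IH this] show ?case by (simp add: theta30_def)
qed simp

lemma theta30_nth_0: "0 < a \<Longrightarrow> a < 30 \<Longrightarrow> fps_nth (theta30 n a) 0 = 1"
  by (induction n) (simp_all add: theta30_def fps_mult_nth_0 fps_X_power_nth)

lemma theta_prod_reflect: "a \<le> 15 \<Longrightarrow> theta_prod t (15 - a) n = theta_prod t a n"
  by (simp add: theta_prod_def mult.commute)

text \<open>Two consecutive steps of length 15 supply the residues \<open>a\<close>,
  \<open>15 - a\<close>, \<open>15 + a\<close>, \<open>30 - a\<close> modulo 30, that is, one pair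
  for each factor on the right; hence \<open>2 * n\<close> against \<open>n\<close>.\<close>

lemma theta_prod_minus_double:
  assumes "a \<le> 15"
  shows "theta_prod (-1) a (2 * n) = theta30 n a * theta30 n (15 - a)"
proof (induction n)
  case (Suc n)
  have "15 * (2 * n) + a = 30 * n + a" "15 * (2 * n) + (15 - a) = 30 * n + (15 - a)"
    "15 * Suc (2 * n) + a = 30 * n + (30 - (15 - a))" "15 * Suc (2 * n) + (15 - a) = 30 * n + (30 - a)"
    using assms by auto
  then show ?case
    using Suc unfolding theta_prod_def theta30_def mult_Suc_right add_2_eq_Suc prod.lessThan_Suc
    by (simp only:) (simp add: ac_simps flip: fps_const_neg)
qed (simp add: theta_prod_def theta30_def)

lemma theta_prod_plus_minus:
  assumes "a \<le> 15"
  shows "theta_prod 1 a n * theta_prod (-1) a n = theta30 n (2 * a)"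
proof -
  have double: "(1 + fps_X ^ e) * (1 - fps_X ^ e) = (1 - fps_X ^ (2 * e) :: int fps)" for e
  proof -
    have "(1 + y) * (1 - y) = 1 - y * y" for y :: "int fps" by (simp add: algebra_simps)
    then show ?thesis by (simp only: mult_2 power_add)
  qed
  have swap: "(u * v) * (w * z) = (u * w) * (v * z)" for u v w z :: "int fps"
    by (simp only: ac_simps)
  have eq: "((1 + fps_X ^ (15 * k + a)) * (1 + fps_X ^ (15 * k + (15 - a)))) *
      ((1 - fps_X ^ (15 * k + a)) * (1 - fps_X ^ (15 * k + (15 - a)))) =
      (1 - fps_X ^ (2 * (15 * k + a))) * (1 - fps_X ^ (2 * (15 * k + (15 - a))) :: int fps)" for k
    by (subst swap) (simp only: double)
  moreover have "2 * (15 * k + a) = 30 * k + 2 * a" "2 * (15 * k + (15 - a)) = 30 * k + (30 - 2 * a)" for k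
    using assms by auto
  ultimately have "((1 + fps_X ^ (15 * k + a)) * (1 + fps_X ^ (15 * k + (15 - a)))) *
      ((1 + fps_const (-1) * fps_X ^ (15 * k + a)) * (1 + fps_const (-1) * fps_X ^ (15 * k + (15 - a)))) =
      (1 - fps_X ^ (30 * k + 2 * a)) * (1 - fps_X ^ (30 * k + (30 - 2 * a)) :: int fps)" for k
    by (simp only: fps_const_neg[symmetric] fps_const_1_eq_1 mult_minus_left mult_1_left add_uminus_conv_diff)
  then show ?thesis
    by (simp only: theta_prod_def theta30_def prod.distrib[symmetric] fps_const_1_eq_1 mult_1_left)
qed

text \<open>Multiplied by \<open>P\<close>, each theta product becomes congruent to a theta series.
  Every term contains four of them, so \<open>P ^ 4\<close> cancels.\<close>

lemma theta_prod_three_term: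
  fixes n
  defines "N \<equiv> 15 * n - 15" and "K \<equiv> \<lambda>a. theta_prod (-1) a n" and "T \<equiv> \<lambda>a. theta_prod 1 a n"
  shows "fps_cong N (K 6 * K 6 * (T 7 * T 2) - fps_X ^ 2 * (K 3 * K 3 * (T 4 * T 1))) (K 6 * K 3 * (T 5 * T 5))"
proof -
  define P where "P = (pochhammer_q (fps_X ^ 15) n :: int fps)"
  define f where "f = theta_series (-1)"
  define g where "g = theta_series 1"
  have K: "fps_cong N (P * K a) (f (int a))" if "a \<le> 15" for a
    unfolding N_def P_def K_def f_def using that by (intro theta_prod_cong) auto
  have T: "fps_cong N (P * T a) (g (int a))" if "a \<le> 15" for a
    unfolding N_def P_def T_def g_def using that by (intro theta_prod_cong) auto
  note intros = fps_cong_mult fps_cong_diff fps_cong_refl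
  have "fps_cong N
      (P * K 6 * (P * K 6) * (P * T 8 * (P * T 2)) - fps_X ^ 2 * (P * K 3 * (P * K 3) * (P * T 11 * (P * T 1))))
      (f (int 6) * f (int 6) * (g (int 8) * g (int 2)) - fps_X ^ 2 * (f (int 3) * f (int 3) * (g (int 11) * g (int 1))))"
    by (intro intros K T) auto
  also have "\<dots> = f (int 9) * f (int 3) * (g (int 5) * g (int 5))"
    unfolding f_def g_def using theta_series_three_term by simp
  also have "fps_cong N \<dots> (P * K 9 * (P * K 3) * (P * T 5 * (P * T 5)))"
    by (intro fps_cong_sym[OF intros(1)] intros K T) auto
  also have "P * K 6 * (P * K 6) * (P * T 8 * (P * T 2)) - fps_X ^ 2 * (P * K 3 * (P * K 3) * (P * T 11 * (P * T 1))) =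
      P ^ 4 * (K 6 * K 6 * (T 8 * T 2) - fps_X ^ 2 * (K 3 * K 3 * (T 11 * T 1)))"
    by algebra
  also have "P * K 9 * (P * K 3) * (P * T 5 * (P * T 5)) = P ^ 4 * (K 9 * K 3 * (T 5 * T 5))"
    by algebra
  finally have "fps_cong N (K 6 * K 6 * (T 8 * T 2) - fps_X ^ 2 * (K 3 * K 3 * (T 11 * T 1))) (K 9 * K 3 * (T 5 * T 5))"
    by (rule fps_cong_mult_cancel) (simp add: P_def pochhammer_q_nth_0 fps_nth_power_0)
  moreover have "T 8 = T 7" "T 11 = T 4" "K 9 = K 6"
    using theta_prod_reflect[of 7 1 n] theta_prod_reflect[of 4 1 n] theta_prod_reflect[of 6 "-1" n]
    by (simp_all add: T_def K_def)
  ultimately show ?thesis by simp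
qed

lemma theta30_identity:
  fixes n
  defines "J \<equiv> theta30 n"
  shows "fps_cong (30 * n - 15)
    (J 5 ^ 2 * (J 4 ^ 2 * J 6 ^ 2 * J 9 ^ 2 * J 14 ^ 2 * J 1 * J 11 -
       fps_X ^ 2 * (J 2 ^ 2 * J 3 ^ 2 * J 8 ^ 2 * J 12 ^ 2 * J 7 * J 13)))
    (J 1 * J 14 * J 2 * J 13 * J 3 * J 12 * J 4 * J 11 * J 6 * J 9 * J 7 * J 8)"
proof -
  define N where "N = 30 * n - 15"
  \<comment> \<open>\<open>T a * K a\<close> is a truncation at \<open>2 * n\<close>, whereas
    \<open>K a\<close> splits into truncations at \<open>n\<close>; the two agree to the order
    needed.\<close>
  define J' where "J' = theta30 (2 * n)"
  define K where "K = (\<lambda>a. theta_prod (-1) a (2 * n))"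
  define T where "T = (\<lambda>a. theta_prod 1 a (2 * n))"
  have J': "fps_cong N (J a) (J' a)" for a
    unfolding J_def J'_def N_def
    by (rule fps_cong_sym, rule fps_cong_mono, rule theta30_cong) auto
  have K: "K 1 = J 1 * J 14" "K 2 = J 2 * J 13" "K 3 = J 3 * J 12" "K 4 = J 4 * J 11"
    "K 5 = J 5 * J 10" "K 6 = J 6 * J 9" "K 7 = J 7 * J 8"
    by (simp_all add: K_def J_def theta_prod_minus_double)
  have T: "T 1 * K 1 = J' 2" "T 2 * K 2 = J' 4" "T 4 * K 4 = J' 8" "T 5 * K 5 = J' 10" "T 7 * K 7 = J' 14"
    by (simp_all add: K_def T_def J'_def theta_prod_plus_minus)
  \<comment> \<open>\<open>C\<close> completes each \<open>T a\<close> to \<open>T a * K a\<close>.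
    It contains \<open>K 5\<close> twice because of \<open>T 5 * T 5\<close>.\<close>
  define C where "C = K 1 * K 2 * K 4 * K 7 * (K 5 * K 5)"
  note intros = fps_cong_mult fps_cong_diff fps_cong_refl
  have "fps_cong N
      (K 6 * K 6 * K 1 * K 4 * (K 5 * K 5) * (J 14 * J 4) - fps_X ^ 2 * (K 3 * K 3 * K 2 * K 7 * (K 5 * K 5) * (J 8 * J 2)))
      (K 6 * K 6 * K 1 * K 4 * (K 5 * K 5) * (J' 14 * J' 4) - fps_X ^ 2 * (K 3 * K 3 * K 2 * K 7 * (K 5 * K 5) * (J' 8 * J' 2)))"
    by (intro intros J')
  also have "\<dots> = (K 6 * K 6 * (T 7 * T 2) - fps_X ^ 2 * (K 3 * K 3 * (T 4 * T 1))) * C"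
    unfolding C_def T[symmetric] by algebra
  also have "fps_cong N \<dots> (K 6 * K 3 * (T 5 * T 5) * C)"
    using theta_prod_three_term[of "2 * n"] by (intro intros) (simp add: N_def K_def T_def)
  also have "\<dots> = K 6 * K 3 * K 1 * K 2 * K 4 * K 7 * (J' 10 * J' 10)"
    unfolding C_def T[symmetric] by algebra
  also have "fps_cong N \<dots> (K 6 * K 3 * K 1 * K 2 * K 4 * K 7 * (J 10 * J 10))"
    by (intro intros fps_cong_sym[OF J'])
  also have "K 6 * K 3 * K 1 * K 2 * K 4 * K 7 * (J 10 * J 10) = J 10 ^ 2 *
      (J 1 * J 14 * J 2 * J 13 * J 3 * J 12 * J 4 * J 11 * J 6 * J 9 * J 7 * J 8)"
    unfolding K by algebra
  also have "K 6 * K 6 * K 1 * K 4 * (K 5 * K 5) * (J 14 * J 4) - fps_X ^ 2 * (K 3 * K 3 * K 2 * K 7 * (K 5 * K 5) * (J 8 * J 2)) =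
      J 10 ^ 2 * (J 5 ^ 2 * (J 4 ^ 2 * J 6 ^ 2 * J 9 ^ 2 * J 14 ^ 2 * J 1 * J 11 -
       fps_X ^ 2 * (J 2 ^ 2 * J 3 ^ 2 * J 8 ^ 2 * J 12 ^ 2 * J 7 * J 13)))"
    unfolding K by algebra
  finally show ?thesis
    unfolding N_def by (rule fps_cong_mult_cancel) (simp add: J_def fps_nth_power_0 theta30_nth_0)
qed

section \<open>Euler products of the three color patterns in terms of \<open>theta30\<close>\<close>

lemma num_colors_periodic: "num_colors R T (30 * k + r) = num_colors R T r"
  by (simp add: num_colors_def in_pm_classes30_def cong_def)

lemma prod_blocks:
  "(\<Prod>k=1..m * n. f k) = (\<Prod>l<n. \<Prod>r=1..m. f (m * l + r :: nat))"
proof (induction n)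
  case (Suc n)
  have "m * Suc n = m * n + m" by simp
  then have "(\<Prod>k=1..m * Suc n. f k) = (\<Prod>k=1..m * n. f k) * (\<Prod>k=m * n + 1..m * n + m. f k)"
    using prod.ub_add_nat[of 1 "m * n" f m] by (simp only:)
  also have "(\<Prod>k=m * n + 1..m * n + m. f k) = (\<Prod>r=1..m. f (m * n + r))"
    using prod.shift_bounds_cl_nat_ivl[of f 1 "m * n" m] by (simp only: add.commute)
  finally show ?case using Suc by (simp only: prod.lessThan_Suc)
qed simp

text \<open>Unrolled so that the number of colors can be evaluated residue by residue.\<close>

lemma prod_1_30:
  "(\<Prod>r=1..30. f r) = f 1 * f 2 * f 3 * f 4 * f 5 * f 6 * f 7 * f 8 * f 9 * f 10 *
    f 11 * f 12 * f 13 * f 14 * f 15 * f 16 * f 17 * f 18 * f 19 * f 20 *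
    f 21 * f 22 * f 23 * f 24 * f 25 * f 26 * f 27 * f 28 * f 29 * f (30::nat)"
  by (simp add: numeral_eq_Suc prod.atLeast_Suc_atMost ac_simps)

lemma prod_num_colors:
  "(\<Prod>k=1..30 * n. (1 - fps_X ^ k :: int fps) ^ num_colors R T k) =
    (\<Prod>l<n. \<Prod>r=1..30. (1 - fps_X ^ (30 * l + r)) ^ num_colors R T r)"
  unfolding prod_blocks num_colors_periodic ..

lemma prod_p4:
  fixes n defines "J \<equiv> theta30 n"
  shows "(\<Prod>k=1..30 * n. (1 - fps_X ^ k) ^ num_colors {2, 3, 7, 8, 12, 13} {2, 3, 8, 12} k) =
    J 2 ^ 2 * J 3 ^ 2 * J 8 ^ 2 * J 12 ^ 2 * J 7 * J 13"
proof -
  \<comment> \<open>Residues without colors drop out with exponent \<open>0\<close>;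
    \<open>r\<close> and \<open>30 - r\<close> are grouped to match the factor pairs of
    \<open>theta30\<close>.\<close>
  have block: "(\<Prod>r=1..30. f r ^ num_colors {2, 3, 7, 8, 12, 13} {2, 3, 8, 12} r) =
    (f 2 * f 28) ^ 2 * (f 3 * f 27) ^ 2 * (f 8 * f 22) ^ 2 * (f 12 * f 18) ^ 2 * (f 7 * f 23) * (f 13 * f 17)"
    for f :: "nat \<Rightarrow> int fps"
    unfolding prod_1_30
    by (simp add: num_colors_def in_pm_classes30_def cong_def) (simp add: power_mult_distrib ac_simps)
  show ?thesis
    unfolding prod_num_colors block J_def theta30_def prod.distrib prod_power_distrib[symmetric] by simp
qed

lemma prod_p5:
  fixes n defines "J \<equiv> theta30 n"
  shows "(\<Prod>k=1..30 * n. (1 - fps_X ^ k) ^ num_colors {1, 4, 6, 9, 11, 14} {4, 6, 9, 14} k) =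
    J 4 ^ 2 * J 6 ^ 2 * J 9 ^ 2 * J 14 ^ 2 * J 1 * J 11"
proof -
  have block: "(\<Prod>r=1..30. f r ^ num_colors {1, 4, 6, 9, 11, 14} {4, 6, 9, 14} r) =
    (f 4 * f 26) ^ 2 * (f 6 * f 24) ^ 2 * (f 9 * f 21) ^ 2 * (f 14 * f 16) ^ 2 * (f 1 * f 29) * (f 11 * f 19)"
    for f :: "nat \<Rightarrow> int fps"
    unfolding prod_1_30
    by (simp add: num_colors_def in_pm_classes30_def cong_def) (simp add: power_mult_distrib ac_simps)
  show ?thesis
    unfolding prod_num_colors block J_def theta30_def prod.distrib prod_power_distrib[symmetric] by simp
qed

lemma prod_p6:
  fixes n defines "J \<equiv> theta30 n"
  shows "(\<Prod>k=1..30 * n. (1 - fps_X ^ k) ^ num_colors {2, 3, 4, 5, 6, 8, 9, 12, 14} {5} k) =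
    J 2 * J 3 * J 4 * J 5 ^ 2 * J 6 * J 8 * J 9 * J 12 * J 14"
proof -
  have block: "(\<Prod>r=1..30. f r ^ num_colors {2, 3, 4, 5, 6, 8, 9, 12, 14} {5} r) =
    (f 2 * f 28) * (f 3 * f 27) * (f 4 * f 26) * (f 5 * f 25) ^ 2 * (f 6 * f 24) * (f 8 * f 22) * (f 9 * f 21) * (f 12 * f 18) * (f 14 * f 16)"
    for f :: "nat \<Rightarrow> int fps"
    unfolding prod_1_30
    by (simp add: num_colors_def in_pm_classes30_def cong_def) (simp add: power_mult_distrib ac_simps)
  show ?thesis
    unfolding prod_num_colors block J_def theta30_def prod.distrib prod_power_distrib[symmetric] by simp
qed

theorem theorem7p2:
  fixes n :: nat
  assumes "n > 1"
  shows "int (p4 n) - int (p5 (n - 2)) = int (p6 n)"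
proof -
  \<comment> \<open>This gives \<open>N = 30 * n + 15\<close>, so a congruence modulo
    \<open>q^N\<close> determines the coefficient at \<open>n\<close>.\<close>
  define m where "m = n + 1"
  define N where "N = 30 * m - 15"
  define J where "J = theta30 m"
  define P4 where "P4 = Abs_fps (\<lambda>n. int (p4 n))"
  define P5 where "P5 = Abs_fps (\<lambda>n. int (p5 n))"
  define P6 where "P6 = Abs_fps (\<lambda>n. int (p6 n))"
  define E4 where "E4 = J 2 ^ 2 * J 3 ^ 2 * J 8 ^ 2 * J 12 ^ 2 * J 7 * J 13"
  define E5 where "E5 = J 4 ^ 2 * J 6 ^ 2 * J 9 ^ 2 * J 14 ^ 2 * J 1 * J 11"
  define E6 where "E6 = J 2 * J 3 * J 4 * J 5 ^ 2 * J 6 * J 8 * J 9 * J 12 * J 14"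
  \<comment> \<open>\<open>E6\<close> without \<open>J 5 ^ 2\<close>; it also supplies the second
    copies of the factors squared in \<open>E4 * E5\<close>.\<close>
  define Q where "Q = J 2 * J 3 * J 8 * J 12 * J 4 * J 6 * J 9 * J 14"
  have le: "N \<le> Suc (30 * m)" by (simp add: N_def)
  have P: "fps_cong N (P4 * E4) 1" "fps_cong N (P5 * E5) 1" "fps_cong N (P6 * E6) 1"
    unfolding P4_def P5_def P6_def E4_def E5_def E6_def J_def p4_def p5_def p6_def
      prod_p4[symmetric] prod_p5[symmetric] prod_p6[symmetric]
    by (rule fps_cong_mono[OF fps_colored_partitions le])+
  note intros = fps_cong_mult fps_cong_diff fps_cong_refl
  have "fps_cong N (J 5 ^ 2 * (E5 - fps_X ^ 2 * E4) * Q)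
      (J 1 * J 14 * J 2 * J 13 * J 3 * J 12 * J 4 * J 11 * J 6 * J 9 * J 7 * J 8 * Q)"
    unfolding N_def E4_def E5_def J_def by (intro intros theta30_identity)
  also have "J 5 ^ 2 * (E5 - fps_X ^ 2 * E4) * Q = E6 * (E5 - fps_X ^ 2 * E4)"
    unfolding E6_def Q_def by algebra
  also have "J 1 * J 14 * J 2 * J 13 * J 3 * J 12 * J 4 * J 11 * J 6 * J 9 * J 7 * J 8 * Q = E4 * E5"
    unfolding E4_def E5_def Q_def by algebra
  finally have E: "fps_cong N (E6 * (E5 - fps_X ^ 2 * E4)) (E4 * E5)" .
  \<comment> \<open>Factors congruent to \<open>1\<close> are inserted so that
    \<open>P4 * P5 * P6\<close> can be pulled out and \<open>E\<close> applied.\<close>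
  have "fps_cong N (1 * 1 * P4 - fps_X ^ 2 * (1 * 1 * P5))
      (P6 * E6 * (P5 * E5) * P4 - fps_X ^ 2 * (P6 * E6 * (P4 * E4) * P5))"
    by (intro intros P[THEN fps_cong_sym])
  also have "\<dots> = P4 * P5 * P6 * (E6 * (E5 - fps_X ^ 2 * E4))" by algebra
  also have "fps_cong N \<dots> (P4 * P5 * P6 * (E4 * E5))" by (intro intros E)
  also have "\<dots> = P4 * E4 * (P5 * E5) * P6" by algebra
  also have "fps_cong N \<dots> (1 * 1 * P6)" by (intro intros P)
  finally have "fps_nth (P4 - fps_X ^ 2 * P5) n = fps_nth P6 n"
    by (intro fps_cong_nth) (auto simp: N_def m_def)
  then show ?thesis
    using assms by (simp add: P4_def P5_def P6_def fps_X_power_mult_nth)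
qed

end
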